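(* Let $L$ be the graph with vertex set $\{0,1\}^2=\{00,01,10,11\}$ whose edge set is $\{\{00,01\},\{00,10\},\{00,11\}\}$ (all three edges incident to $00$). Then $$C_M(L)=\log_2\gamma\approx 0.81,$$ where $\gamma^{-1}$ is the unique positive root of the equation $x+\frac{x^3}{1-x}=1$.
   Context: Let $G$ be a simple graph with vertex set $\{0,1\}^2$, the set of ordered pairs of binary symbols (written as strings $ab$), whose edges are unordered pairs of distinct vertices. Two sequences $\mathbf{x}=(x_1,\dots,x_n),\mathbf{y}=(y_1,\dots,y_n)\in\{0,1\}^n$ are called distinguishable for $G$ if there exists $i\in\{1,\dots,n-1\}$ such that $\{x_ix_{i+1},\,y_iy_{i+1}\}$ is an edge of $G$. Let $M(G,n)$ be the largest cardinality of a set $C\subseteq\{0,1\}^n$ any two distinct elements of which are distinguishable for $G$. The Shannon–Markov capacity of $G$ is $C_M(G)=\limsup_{n\to\infty}\frac1n\log_2 M(G,n)$. *)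

theory Defs
  imports "HOL-Library.Z2" "HOL-Library.Extended_Real" "HOL-Library.Liminf_Limsup" Complex_Main
begin

text \<open>A graph with vertex set $\{0,1\}^2$ is given by its set of edges; the vertex set is the whole
  type \<open>bit \<times> bit\<close>, the string $ab$ being the pair \<open>(a, b)\<close>.\<close>

type_synonym pair_graph = "(bit \<times> bit) set set"

definition simple_graph :: "pair_graph \<Rightarrow> bool" where
  "simple_graph G \<longleftrightarrow> (\<forall>e\<in>G. card e = 2)"

text \<open>List positions count from 0, so the index $i \in \{1,\dots,n-1\}$ becomes \<open>i < n - 1\<close>.\<close>

definition distinguishable :: "pair_graph \<Rightarrow> nat \<Rightarrow> bit list \<Rightarrow> bit list \<Rightarrow> bool" where
  "distinguishable G n x y \<longleftrightarrow>
     (\<exists>i<n - 1. {(x ! i, x ! (i + 1)), (y ! i, y ! (i + 1))} \<in> G)"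

definition sequences :: "nat \<Rightarrow> bit list set" where
  "sequences n = {x. length x = n}"

definition max_code :: "pair_graph \<Rightarrow> nat \<Rightarrow> nat" where
  "max_code G n = Max {card C | C. C \<subseteq> sequences n \<and>
     (\<forall>x\<in>C. \<forall>y\<in>C. x \<noteq> y \<longrightarrow> distinguishable G n x y)}"

definition shannon_markov_capacity :: "pair_graph \<Rightarrow> ereal" where
  "shannon_markov_capacity G =
     limsup (\<lambda>n. ereal (1 / real n * log 2 (real (max_code G n))))"

definition graph_L :: pair_graph where
  "graph_L = {{(0, 0), (0, 1)}, {(0, 0), (1, 0)}, {(0, 0), (1, 1)}}"

lemma simple_graph_L: "simple_graph graph_L"
  by (simp add: simple_graph_def graph_L_def)

lemma finite_sequences: "finite (sequences n)"
proof -
  have "(UNIV :: bit set) = {0, 1}"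
    using bit_not_one_iff by blast
  then have "finite (UNIV :: bit set)"
    by (metis finite.emptyI finite.insertI)
  from finite_lists_length_eq[OF this, of n] show ?thesis
    by (simp add: sequences_def)
qed

text \<open>The maximum in \<open>max_code\<close> is taken over a finite nonempty set.\<close>

lemma finite_code_cards:
  "finite {card C | C. C \<subseteq> sequences n \<and>
     (\<forall>x\<in>C. \<forall>y\<in>C. x \<noteq> y \<longrightarrow> distinguishable G n x y)}"
  by (rule finite_subset[of _ "card ` Pow (sequences n)"]) (auto simp: finite_sequences)

lemma code_cards_nonempty:
  "{card C | C. C \<subseteq> sequences n \<and>
     (\<forall>x\<in>C. \<forall>y\<in>C. x \<noteq> y \<longrightarrow> distinguishable G n x y)} \<noteq> {}"
  by blast

text \<open>In HOL \<open>a / 0 = 0\<close>, so \<open>x = 1\<close> formally satisfies the equation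
  \<open>x + x ^ 3 / (1 - x) = 1\<close>; it is excluded because the left-hand side is undefined there.\<close>

definition is_positive_root :: "real \<Rightarrow> bool" where
  "is_positive_root x \<longleftrightarrow> x > 0 \<and> x \<noteq> 1 \<and> x + x ^ 3 / (1 - x) = 1"

end

theory Submission
  imports Defs
begin

text \<open>Two sequences are distinguishable for \<open>L\<close> iff the sets of positions at which the block
  \<open>00\<close> starts differ, so the maximal code size is the number of sets of positions that occur. Writing
  \<open>A n\<close> and \<open>B n\<close> for the patterns of the words of length \<open>n\<close> preceded by a \<open>1\<close> and by a \<open>0\<close>,
  the numbers \<open>a = |A n|\<close>, \<open>b = |B n|\<close>, \<open>d = |A n \<union> B n|\<close> satisfy the linear recursion
  \<open>(a, b, d) \<mapsto> (d, a + b, b + d)\<close>. Its matrix has the positive eigenvector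
  \<open>(1, \<gamma> (\<gamma> - 1), \<gamma>)\<close> for the eigenvalue \<open>\<gamma>\<close>, hence \<open>\<gamma> ^ n / \<gamma> \<le> a \<le> \<gamma> ^ n\<close>.\<close>

text \<open>The argument \<open>p\<close> is the letter before the word. Entry \<open>i\<close>
  marks a block \<open>00\<close> ending at position \<open>i\<close>, so for \<open>p = 1\<close>
  entry 0 is always \<open>False\<close>.\<close>

fun zero_pattern :: "bit \<Rightarrow> bit list \<Rightarrow> bool list" where
  "zero_pattern p [] = []"
| "zero_pattern p (x # xs) = (p = 0 \<and> x = 0) # zero_pattern x xs"

lemma length_zero_pattern [simp]: "length (zero_pattern p xs) = length xs"
  by (induction xs arbitrary: p) auto

lemma nth_zero_pattern:
  "i < length xs \<Longrightarrow> zero_pattern p xs ! i \<longleftrightarrow> (p # xs) ! i = 0 \<and> xs ! i = 0"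
proof (induction xs arbitrary: p i)
  case Nil
  then show ?case by simp
next
  case (Cons x xs)
  then show ?case by (cases i) auto
qed

text \<open>\<open>graph_L\<close> is a star centred at \<open>00\<close>: it only sees whether a
  block is \<open>00\<close>.\<close>

lemma mem_graph_L_iff:
  "{(a, b), (c, d)} \<in> graph_L \<longleftrightarrow> (a = 0 \<and> b = 0) \<noteq> (c = 0 \<and> d = 0)"
  by (cases a; cases b; cases c; cases d) (auto simp: graph_L_def doubleton_eq_iff)

lemma distinguishable_graph_L_iff:
  assumes "length x = n" "length y = n"
  shows "distinguishable graph_L n x y \<longleftrightarrow> zero_pattern 1 x \<noteq> zero_pattern 1 y"
proof -
  have "zero_pattern 1 x = zero_pattern 1 y \<longleftrightarrow>
      (\<forall>j<n. zero_pattern 1 x ! j = zero_pattern 1 y ! j)"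
    using assms by (simp add: list_eq_iff_nth_eq)
  also have "\<dots> \<longleftrightarrow> (\<forall>i<n - 1. zero_pattern 1 x ! Suc i = zero_pattern 1 y ! Suc i)"
  proof (rule iffI; intro allI impI)
    fix j
    assume *: "\<forall>i<n - 1. zero_pattern 1 x ! Suc i = zero_pattern 1 y ! Suc i" and "j < n"
    \<comment> \<open>At \<open>j = 0\<close> both entries are \<open>False\<close>; this bridges
      the \<open>n\<close> entries and the \<open>n - 1\<close> blocks.\<close>
    then show "zero_pattern 1 x ! j = zero_pattern 1 y ! j"
      using assms by (cases j) (auto simp: nth_zero_pattern)
  qed auto
  also have "\<dots> \<longleftrightarrow> (\<forall>i<n - 1. (x ! i = 0 \<and> x ! Suc i = 0) = (y ! i = 0 \<and> y ! Suc i = 0))"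
    using assms by (simp add: nth_zero_pattern)
  finally show ?thesis
    by (auto simp: distinguishable_def mem_graph_L_iff)
qed

abbreviation patterns :: "bit \<Rightarrow> nat \<Rightarrow> bool list set" where
  "patterns p n \<equiv> zero_pattern p ` sequences n"

lemma finite_patterns [simp]: "finite (patterns p n)"
  by (simp add: finite_sequences)

text \<open>Codes are the sets of words on which \<open>zero_pattern 1\<close> is injective;
  choosing one word per pattern attains the bound.\<close>

lemma max_code_graph_L: "max_code graph_L n = card (patterns 1 n)"
  unfolding max_code_def
proof (rule Max_eqI[OF finite_code_cards])
  fix k
  assume "k \<in> {card C | C. C \<subseteq> sequences n \<and>
    (\<forall>x\<in>C. \<forall>y\<in>C. x \<noteq> y \<longrightarrow> distinguishable graph_L n x y)}"
  then obtain C where C: "k = card C" "C \<subseteq> sequences n"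
    "\<forall>x\<in>C. \<forall>y\<in>C. x \<noteq> y \<longrightarrow> distinguishable graph_L n x y"
    by auto
  then have "inj_on (zero_pattern 1) C"
    by (intro inj_onI) (metis (mono_tags, lifting) distinguishable_graph_L_iff mem_Collect_eq
        sequences_def subsetD)
  then show "k \<le> card (patterns 1 n)"
    using C by (metis card_image card_mono finite_patterns image_mono)
next
  obtain C where "C \<subseteq> sequences n" "inj_on (zero_pattern 1) C"
    "zero_pattern 1 ` C = patterns 1 n"
    by (metis subset_image_inj subset_refl)
  then have "card (patterns 1 n) = card C \<and> C \<subseteq> sequences n \<and>
      (\<forall>x\<in>C. \<forall>y\<in>C. x \<noteq> y \<longrightarrow> distinguishable graph_L n x y)"
    by (metis (mono_tags, lifting) card_image distinguishable_graph_L_iff inj_onD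
        mem_Collect_eq sequences_def subsetD)
  then show "card (patterns 1 n) \<in> {card C | C. C \<subseteq> sequences n \<and>
      (\<forall>x\<in>C. \<forall>y\<in>C. x \<noteq> y \<longrightarrow> distinguishable graph_L n x y)}"
    by blast
qed

lemma sequences_0: "sequences 0 = {[]}"
  by (auto simp: sequences_def)

lemma sequences_Suc: "sequences (Suc n) = (#) 0 ` sequences n \<union> (#) 1 ` sequences n"
proof -
  have "x \<in> sequences (Suc n) \<longleftrightarrow> x \<in> (#) 0 ` sequences n \<union> (#) 1 ` sequences n" for x
  proof (cases x)
    case (Cons b xs)
    then show ?thesis by (cases b) (auto simp: sequences_def)
  qed (auto simp: sequences_def)
  then show ?thesis by blast
qed

text \<open>After a 1 the first entry hides the next letter, so the two cases can share patterns and
  their union must be counted separately.\<close>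

lemma patterns_1_Suc: "patterns 1 (Suc n) = (#) False ` (patterns 1 n \<union> patterns 0 n)"
  by (auto simp: sequences_Suc image_Un image_image)

text \<open>After a 0 the first entry reveals the next letter, so the sizes add.\<close>

lemma patterns_0_Suc: "patterns 0 (Suc n) = (#) False ` patterns 1 n \<union> (#) True ` patterns 0 n"
  by (auto simp: sequences_Suc image_Un image_image)

lemma patterns_Un_Suc:
  "patterns 1 (Suc n) \<union> patterns 0 (Suc n) =
     (#) False ` (patterns 1 n \<union> patterns 0 n) \<union> (#) True ` patterns 0 n"
  unfolding patterns_1_Suc patterns_0_Suc by blast

lemma card_False_Un_True:
  assumes "finite A" "finite B"
  shows "card ((#) False ` A \<union> (#) True ` B) = card A + card B"
  using assms by (subst card_Un_disjoint) (auto simp: card_image)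

lemma card_patterns_bounds:
  fixes g :: real
  assumes g: "g ^ 3 = 2 * g ^ 2 - g + 1" "1.754 < g" "g < 1.756"
  defines "a n \<equiv> real (card (patterns 1 n))"
    and "b n \<equiv> real (card (patterns 0 n))"
    and "d n \<equiv> real (card (patterns 1 n \<union> patterns 0 n))"
  shows "g ^ n / g \<le> a n" "a n \<le> g ^ n"
proof -
  \<comment> \<open>Second coordinate of the eigenvector equation; the other two are identities in
    \<open>g\<close>.\<close>
  have eq: "g * (g * (g - 1)) = 1 + g * (g - 1)"
    using g(1) by (simp add: power3_eq_cube power2_eq_square algebra_simps)
  have g1: "1 \<le> g * (g - 1)"
    using mult_mono[of "1.754" g "0.754" "g - 1"] g by simp
  have init: "a 0 = 1" "b 0 = 1" "d 0 = 1"
    by (simp_all add: a_def b_def d_def sequences_0)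
  have step: "a (Suc n) = d n" "b (Suc n) = a n + b n" "d (Suc n) = b n + d n" for n
    unfolding a_def b_def d_def patterns_Un_Suc unfolding patterns_1_Suc patterns_0_Suc
    by (simp_all add: card_False_Un_True card_image)
  \<comment> \<open>The initial vector (1, 1, 1) lies below the eigenvector, and nonnegative
    coefficients preserve this.\<close>
  have "a n \<le> g ^ n \<and> b n \<le> g ^ n * (g * (g - 1)) \<and> d n \<le> g ^ n * g"
  proof (induction n)
    case 0
    then show ?case using g g1 init by simp
  next
    case (Suc n)
    have "g ^ Suc n * (g * (g - 1)) = g ^ n * (1 + g * (g - 1))"
      by (metis eq mult.assoc power_Suc2)
    then show ?case using Suc.IH by (simp add: step algebra_simps)
  qed
  then show "a n \<le> g ^ n" by blast
  \<comment> \<open>Conversely the eigenvector lies below \<open>g\<close> times (1, 1, 1), since 1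
    \<le> \<open>g\<close> \<le> 2.\<close>
  have "g ^ n \<le> g * a n \<and> g ^ n * (g * (g - 1)) \<le> g * b n \<and> g ^ n * g \<le> g * d n"
  proof (induction n)
    case 0
    then show ?case using g init by simp
  next
    case (Suc n)
    have "g ^ Suc n * (g * (g - 1)) = g ^ n * (1 + g * (g - 1))"
      by (metis eq mult.assoc power_Suc2)
    then show ?case using Suc.IH by (simp add: step algebra_simps)
  qed
  then show "g ^ n / g \<le> a n"
    using g by (simp add: divide_le_eq mult.commute)
qed

text \<open>Clearing the denominator gives \<open>x ^ 3 = (1 - x) ^ 2\<close>. At the excluded
  \<open>x = 1\<close> the cubic has value 1, so both sides fail.\<close>

lemma is_positive_root_iff: "is_positive_root x \<longleftrightarrow> x > 0 \<and> x ^ 3 - x ^ 2 + 2 * x - 1 = 0"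
proof (cases "x = 1")
  case False
  then have "x + x ^ 3 / (1 - x) = 1 \<longleftrightarrow> x ^ 3 - x ^ 2 + 2 * x - 1 = 0"
    by (simp add: field_simps power2_eq_square) linarith
  then show ?thesis using False by (simp add: is_positive_root_def)
qed (simp add: is_positive_root_def)

lemma cubic_strict_mono:
  fixes x y :: real
  assumes "x < y"
  shows "x ^ 3 - x ^ 2 + 2 * x - 1 < y ^ 3 - y ^ 2 + 2 * y - 1"
proof -
  \<comment> \<open>This is twice the difference quotient of the cubic, written as squares plus
    3.\<close>
  have "0 < (x + y - 1) ^ 2 + x ^ 2 + y ^ 2 + 3"
    by (intro add_nonneg_pos add_nonneg_nonneg) auto
  then have "0 < (y - x) * ((x + y - 1) ^ 2 + x ^ 2 + y ^ 2 + 3)"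
    using assms by simp
  also have "\<dots> = 2 * ((y ^ 3 - y ^ 2 + 2 * y - 1) - (x ^ 3 - x ^ 2 + 2 * x - 1))"
    by (simp add: power3_eq_cube power2_eq_square algebra_simps)
  finally show ?thesis by simp
qed

lemma ex1_positive_root: "\<exists>!x. is_positive_root x"
proof (rule ex_ex1I)
  \<comment> \<open>The cubic is -1 at 0 and 1 at 1.\<close>
  have "\<exists>x\<ge>0. x \<le> 1 \<and> x ^ 3 - x ^ 2 + 2 * x - 1 = (0::real)"
    by (rule IVT') (auto intro!: continuous_intros)
  then obtain x :: real where "x \<ge> 0" "x ^ 3 - x ^ 2 + 2 * x - 1 = 0"
    by blast
  moreover from this have "x \<noteq> 0" by auto
  ultimately show "\<exists>x. is_positive_root x"
    by (auto simp: is_positive_root_iff intro!: exI[of _ x])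
next
  fix x y
  assume "is_positive_root x" "is_positive_root y"
  then show "x = y"
    using cubic_strict_mono[of x y] cubic_strict_mono[of y x]
    by (force simp: is_positive_root_iff)
qed

lemma inverse_root_bounds:
  assumes "is_positive_root (inverse g)"
  shows "g ^ 3 = 2 * g ^ 2 - g + 1" "1.754 < g" "g < 1.756"
proof -
  define x where "x = inverse g"
  have x: "x > 0" "x ^ 3 - x ^ 2 + 2 * x - 1 = 0" and g: "g = 1 / x"
    using assms by (auto simp: is_positive_root_iff x_def field_simps)
  show "g ^ 3 = 2 * g ^ 2 - g + 1"
    using x by (simp add: g field_simps power2_eq_square power3_eq_cube)
  have "x < 1000 / 1754"
  proof (rule ccontr)
    assume "\<not> x < 1000 / 1754"
    \<comment> \<open>This is 1 / 1.7545, slightly below \<open>1000 / 1754\<close>: the inequality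
      becomes strict, and the cubic is still positive there.\<close>
    then have "2000 / 3509 < x" by simp
    from cubic_strict_mono[OF this] x(2) show False by (simp add: power_divide)
  qed
  then show "1.754 < g" using x(1) by (simp add: g field_simps)
  have "1000 / 1756 < x"
  proof (rule ccontr)
    assume "\<not> 1000 / 1756 < x"
    then have "x < 1000 / 1755" by simp
    from cubic_strict_mono[OF this] x(2) show False by (simp add: power_divide)
  qed
  then show "g < 1.756" using x(1) by (simp add: g field_simps)
qed

text \<open>The exponents come from \<open>17 / 21 < log 2 g < 13 / 16\<close>.\<close>

lemma log_2_bounds:
  fixes g :: real
  assumes "1.754 < g" "g < 1.756"
  shows "\<bar>log 2 g - 0.81\<bar> < 0.005"
proof -
  have "(2::real) ^ 17 < 1.754 ^ 21"
    by (simp add: power_divide)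
  also have "\<dots> < g ^ 21"
    using assms by (intro power_strict_mono) auto
  finally have "log 2 (2 ^ 17) < log 2 (g ^ 21)"
    using assms by (subst log_less_cancel_iff) auto
  then have lower: "17 < 21 * log 2 g"
    using assms by (simp only: log_nat_power) (simp add: log_nat_power)
  have "g ^ 16 < 1.756 ^ 16"
    using assms by (intro power_strict_mono) auto
  also have "\<dots> < (2::real) ^ 13"
    by (simp add: power_divide)
  finally have "log 2 (g ^ 16) < log 2 (2 ^ 13)"
    using assms by (subst log_less_cancel_iff) auto
  then have "16 * log 2 g < 13"
    using assms by (simp only: log_nat_power) (simp add: log_nat_power)
  with lower show ?thesis by (simp add: abs_if)
qed

lemma capacity_graph_L:
  assumes "is_positive_root (inverse g)"
  shows "shannon_markov_capacity graph_L = ereal (log 2 g)"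
proof -
  note g = inverse_root_bounds[OF assms]
  define f where "f n = 1 / real n * log 2 (real (max_code graph_L n))" for n
  have "f \<longlonglongrightarrow> log 2 g"
  proof (rule tendsto_sandwich)
    \<comment> \<open>The factor \<open>1 / g\<close> costs only \<open>log 2 g / n\<close>, which
      vanishes in the limit. At \<open>n = 0\<close> division by zero would turn the lower bound
      into the false \<open>log 2 g \<le> 0\<close>.\<close>
    have bounds: "log 2 g - log 2 g * (1 / real n) \<le> f n \<and> f n \<le> log 2 g" if "n > 0" for n
    proof -
      note M = card_patterns_bounds[OF g, of n, folded max_code_graph_L]
      have pos: "0 < g ^ n / g" using g by simp
      have "log 2 (g ^ n / g) \<le> log 2 (max_code graph_L n)"
        using M(1) pos by (subst log_le_cancel_iff) auto
      moreover have "log 2 (max_code graph_L n) \<le> log 2 (g ^ n)"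
        using M pos g by (subst log_le_cancel_iff) linarith+
      ultimately have "real n * log 2 g - log 2 g \<le> real n * f n" "real n * f n \<le> real n * log 2 g"
        using that g by (simp_all add: f_def log_divide log_nat_power)
      moreover have "real n * log 2 g - log 2 g = real n * (log 2 g - log 2 g * (1 / real n))"
        using that by (simp add: right_diff_distrib)
      ultimately show ?thesis
        using that by simp
    qed
    show "\<forall>\<^sub>F n in sequentially. log 2 g - log 2 g * (1 / real n) \<le> f n"
      "\<forall>\<^sub>F n in sequentially. f n \<le> log 2 g"
      using eventually_gt_at_top[of 0] by (eventually_elim, use bounds in blast)+
    have "(\<lambda>n. log 2 g - log 2 g * (1 / real n)) \<longlonglongrightarrow> log 2 g - log 2 g * 0"
      by (intro tendsto_intros lim_1_over_n)
    then show "(\<lambda>n. log 2 g - log 2 g * (1 / real n)) \<longlonglongrightarrow> log 2 g" by simp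
  qed simp
  then have "limsup (\<lambda>n. ereal (f n)) = ereal (log 2 g)"
    by (intro lim_imp_Limsup) auto
  then show ?thesis by (simp add: shannon_markov_capacity_def f_def)
qed

theorem theorem3:
  "(\<exists>!x. is_positive_root x) \<and>
   (\<forall>\<gamma>::real. is_positive_root (inverse \<gamma>) \<longrightarrow>
      shannon_markov_capacity graph_L = ereal (log 2 \<gamma>) \<and>
      \<bar>log 2 \<gamma> - 0.81\<bar> < 0.005)"
  using ex1_positive_root capacity_graph_L log_2_bounds inverse_root_bounds by blast

end
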